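(* Let $\Gamma$ be a finitely generated group. The image of the linear map $\varepsilon_3^*\colon\mathcal{P}(\Gamma)\to \Lambda^3H_1(\Gamma,\mathbb{C})^*$ is the space $$\mathcal{E}(\Gamma)=\left\{\Phi\colon\Lambda^3H_1(\Gamma,\mathbb{C})\to\mathbb{C}\ \text{linear}\ \mid\ \forall x\in H_1(\Gamma,\mathbb{C}),\ \forall y\in H_2(\Gamma,\mathbb{C}),\ \Phi(x\wedge c(y))=0\right\}.$$
   Context: $\mathcal{P}(\Gamma)$ is the complex vector space of all functions $f\colon\Gamma\to\mathbb{C}$ satisfying the parallelogram identity $f(xy)+f(xy^{-1})=2f(x)+2f(y)$ for all $x,y\in\Gamma$. Any function $f\colon\Gamma\to\mathbb{C}$ is extended linearly to the group algebra $\mathbb{C}[\Gamma]$. For $f\in\mathcal{P}(\Gamma)$, the map $(\gamma_1,\gamma_2,\gamma_3)\mapsto f((\gamma_1-1)(\gamma_2-1)(\gamma_3-1))$ is an alternating map $\Gamma^3\to\mathbb{C}$ which is a group morphism in each variable; hence it induces a linear form on $\Lambda^3H_1(\Gamma,\mathbb{C})$, and this linear form is denoted $\varepsilon_3^*(f)$. $c\colon H_2(\Gamma,\mathbb{C})\to\Lambda^2H_1(\Gamma,\mathbb{C})$ is the linear map dual to the cup product $H^1(\Gamma,\mathbb{C})\times H^1(\Gamma,\mathbb{C})\to H^2(\Gamma,\mathbb{C})$: identifying $H^i(\Gamma,\mathbb{C})=\mathrm{Hom}(H_i(\Gamma,\mathbb{C}),\mathbb{C})$, it satisfies $(\alpha\wedge\beta)(c(y))=(\alpha\cup\beta)(y)$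 for all $\alpha,\beta\in H^1(\Gamma,\mathbb{C})$, $y\in H_2(\Gamma,\mathbb{C})$, where $(\alpha\wedge\beta)(u\wedge v)=\alpha(u)\beta(v)-\alpha(v)\beta(u)$. Equivalently (up to a sign, which does not affect $\mathcal{E}(\Gamma)$), writing $\Gamma=F/R$ with $F$ free and $H_2(\Gamma,\mathbb{Z})=([F,F]\cap R)/[F,R]$ by Hopf's formula, $c$ sends the class of $\prod_i[b_i,c_i]$ to $\sum_i \overline{b_i}\wedge\overline{c_i}$, where bars denote images in $H_1(\Gamma,\mathbb{C})$. *)

theory Defs
  imports Complex_Main "HOL-Library.Poly_Mapping"
begin

text \<open>
  The group \<open>\<Gamma>\<close> is a type of class \<^class>\<open>group_add\<close>. This class is not commutative; the
  group law is merely written additively, so \<open>a + b\<close>, \<open>- a\<close>, \<open>a - b\<close> and \<open>0\<close> stand for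
  \<open>ab\<close>, \<open>a\<^sup>-\<^sup>1\<close>, \<open>ab\<^sup>-\<^sup>1\<close> and \<open>1\<close>. In this notation the group algebra \<open>\<complex>[\<Gamma>]\<close> is the ring
  \<open>'g \<Rightarrow>\<^sub>0 complex\<close> of \<^theory>\<open>HOL-Library.Poly_Mapping\<close> with its convolution product, and a group
  element \<open>a\<close> is the basis vector \<open>basis a\<close>.
\<close>


definition finitely_generated :: "'g::group_add set \<Rightarrow> bool" where
  "finitely_generated G \<longleftrightarrow> (\<exists>S. finite S \<and>
     (\<lambda>H. 0 \<in> H \<and> (\<forall>x\<in>H. \<forall>y\<in>H. x + y \<in> H) \<and> (\<forall>x\<in>H. - x \<in> H)) hull S = G)"


section \<open>Complex vector spaces and linear extension\<close>

class scaleC =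
  fixes scaleC :: "complex \<Rightarrow> 'a \<Rightarrow> 'a"  (infixr \<open>*\<^sub>C\<close> 75)

class complex_vector = scaleC + ab_group_add +
  assumes scaleC_add_right: "a *\<^sub>C (x + y) = a *\<^sub>C x + a *\<^sub>C y"
    and scaleC_add_left: "(a + b) *\<^sub>C x = a *\<^sub>C x + b *\<^sub>C x"
    and scaleC_scaleC: "a *\<^sub>C b *\<^sub>C x = (a * b) *\<^sub>C x"
    and scaleC_one: "1 *\<^sub>C x = x"

global_interpretation complex_vector: vector_space "scaleC :: complex \<Rightarrow> 'a \<Rightarrow> 'a::complex_vector"
  by unfold_locales (simp_all add: scaleC_add_right scaleC_add_left scaleC_scaleC scaleC_one)

global_interpretation complex_vector_pair:
  vector_space_pair "scaleC :: complex \<Rightarrow> 'a \<Rightarrow> 'a::complex_vector"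
    "scaleC :: complex \<Rightarrow> 'b \<Rightarrow> 'b::complex_vector" ..

abbreviation clinear :: "('a::complex_vector \<Rightarrow> 'b::complex_vector) \<Rightarrow> bool" where
  "clinear \<equiv> Vector_Spaces.linear scaleC scaleC"

instantiation complex :: complex_vector
begin
definition scaleC_complex_def [simp]: "c *\<^sub>C (z::complex) = c * z"
instance by standard (simp_all add: algebra_simps)
end

instantiation poly_mapping :: (type, complex_vector) complex_vector
begin
definition scaleC_poly_mapping :: "complex \<Rightarrow> ('a \<Rightarrow>\<^sub>0 'b) \<Rightarrow> 'a \<Rightarrow>\<^sub>0 'b" where
  "scaleC_poly_mapping c = Poly_Mapping.map (scaleC c)"

lemma lookup_scaleC [simp]: "Poly_Mapping.lookup (c *\<^sub>C p) x = c *\<^sub>C Poly_Mapping.lookup p x"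
  by (simp add: scaleC_poly_mapping_def Poly_Mapping.map.rep_eq when_def)

instance
  by standard
    (rule poly_mapping_eqI; simp add: lookup_add complex_vector.scale_right_distrib
      complex_vector.scale_left_distrib)+
end

abbreviation basis :: "'x \<Rightarrow> 'x \<Rightarrow>\<^sub>0 complex" where
  "basis x \<equiv> Poly_Mapping.single x 1"

definition lin_ext :: "('x \<Rightarrow> 'v::complex_vector) \<Rightarrow> ('x \<Rightarrow>\<^sub>0 complex) \<Rightarrow> 'v" where
  "lin_ext f p = (\<Sum>x\<in>Poly_Mapping.keys p. Poly_Mapping.lookup p x *\<^sub>C f x)"

lemma clinearI:
  assumes "\<And>x y. f (x + y) = f x + f y" "\<And>c x. f (c *\<^sub>C x) = c *\<^sub>C f x"
  shows "clinear f"
  by unfold_locales (use assms in auto)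

lemma clinearD:
  assumes "clinear f"
  shows "f (x + y) = f x + f y" "f (x - y) = f x - f y" "f (c *\<^sub>C x) = c *\<^sub>C f x"
    "f 0 = 0" "f (- x) = - f x" "f (sum g A) = (\<Sum>a\<in>A. f (g a))"
proof -
  interpret Vector_Spaces.linear scaleC scaleC f by fact
  show "f (x + y) = f x + f y" "f (x - y) = f x - f y" "f (c *\<^sub>C x) = c *\<^sub>C f x"
    "f 0 = 0" "f (- x) = - f x" "f (sum g A) = (\<Sum>a\<in>A. f (g a))"
    by (simp_all add: add diff scale neg sum)
qed

lemma lin_ext_superset:
  assumes "finite A" "Poly_Mapping.keys p \<subseteq> A"
  shows "lin_ext f p = (\<Sum>x\<in>A. Poly_Mapping.lookup p x *\<^sub>C f x)"
  unfolding lin_ext_def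
  by (rule sum.mono_neutral_left) (use assms in \<open>auto simp: in_keys_iff\<close>)

lemma clinear_lin_ext: "clinear (lin_ext f)"
proof (rule clinearI)
  fix p q :: "'a \<Rightarrow>\<^sub>0 complex" and c :: complex
  let ?A = "Poly_Mapping.keys p \<union> Poly_Mapping.keys q"
  have "lin_ext f (p + q) = (\<Sum>x\<in>?A. Poly_Mapping.lookup (p + q) x *\<^sub>C f x)"
    by (rule lin_ext_superset) (auto simp: keys_add)
  also have "\<dots> = (\<Sum>x\<in>?A. Poly_Mapping.lookup p x *\<^sub>C f x) + (\<Sum>x\<in>?A. Poly_Mapping.lookup q x *\<^sub>C f x)"
    by (simp add: lookup_add complex_vector.scale_left_distrib sum.distrib)
  also have "\<dots> = lin_ext f p + lin_ext f q"
    using lin_ext_superset[of ?A p f] lin_ext_superset[of ?A q f] by simp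
  finally show "lin_ext f (p + q) = lin_ext f p + lin_ext f q" .
  have "lin_ext f (c *\<^sub>C p) = (\<Sum>x\<in>Poly_Mapping.keys p. Poly_Mapping.lookup (c *\<^sub>C p) x *\<^sub>C f x)"
    by (rule lin_ext_superset) (auto simp: in_keys_iff)
  then show "lin_ext f (c *\<^sub>C p) = c *\<^sub>C lin_ext f p"
    by (simp add: lin_ext_def complex_vector.scale_sum_right)
qed

lemmas lin_ext_simps = clinearD[OF clinear_lin_ext]

lemma lin_ext_single [simp]: "lin_ext f (Poly_Mapping.single x c) = c *\<^sub>C f x"
  by (simp add: lin_ext_def)

lemma lin_ext_mono: "clinear g \<Longrightarrow> g (lin_ext f p) = lin_ext (\<lambda>x. g (f x)) p"
  by (simp add: lin_ext_def clinearD)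

lemma lin_ext_basis: "lin_ext (\<lambda>x. basis x) p = p"
  by (rule poly_mapping_eqI)
    (simp add: lin_ext_def lookup_sum lookup_single when_def in_keys_iff if_distrib[of "(*) _"] cong: if_cong)

lemma clinear_span_image:
  assumes "clinear f" "\<forall>x\<in>S. f x \<in> complex_vector.span T" "x \<in> complex_vector.span S"
  shows "f x \<in> complex_vector.span T"
  using assms(3)
proof (induction rule: complex_vector.span_induct_alt)
  case base
  show ?case by (simp add: clinearD[OF assms(1)] complex_vector.span_zero)
next
  case (step c x y)
  then show ?case
    using assms(2)
    by (simp add: clinearD[OF assms(1)] complex_vector.span_add complex_vector.span_scale)
qed

lemma clinear_span_zero:
  assumes "clinear f" "\<forall>x\<in>S. f x = 0" "x \<in> complex_vector.span S"
  shows "f x = 0"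
  using clinear_span_image[of f S "{}" x] assms by simp


section \<open>Homology of the bar complex in degrees 1 and 2\<close>

text \<open>
  Coefficients are trivial, so the differential of degree 1 is zero and \<open>H\<^sub>1\<close> is the cokernel of
  the differential of degree 2.
\<close>

definition bar_d2 :: "('g::group_add \<times> 'g \<Rightarrow>\<^sub>0 complex) \<Rightarrow> 'g \<Rightarrow>\<^sub>0 complex" where
  "bar_d2 = lin_ext (\<lambda>(a, b). basis b - basis (a + b)
     + basis a)"

definition bar_d3 :: "('g::group_add \<times> 'g \<times> 'g \<Rightarrow>\<^sub>0 complex) \<Rightarrow> 'g \<times> 'g \<Rightarrow>\<^sub>0 complex" where
  "bar_d3 = lin_ext (\<lambda>(a, b, c). basis (b, c) - basis (a + b, c)
     + basis (a, b + c) - basis (a, b))"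

lemma clinear_bar_d2: "clinear bar_d2" and clinear_bar_d3: "clinear bar_d3"
  by (simp_all add: bar_d2_def bar_d3_def clinear_lin_ext)

lemma bar_d2_single: "bar_d2 (basis (a, b)) = basis b - basis (a + b) + basis a"
  by (simp add: bar_d2_def complex_vector.scale_one)

lemma bar_d2_bar_d3: "bar_d2 (bar_d3 p) = 0"
proof -
  have "bar_d2 (bar_d3 p) = lin_ext (\<lambda>x. 0) p"
    unfolding bar_d3_def lin_ext_mono[OF clinear_bar_d2]
    by (rule arg_cong[where f = "\<lambda>f. lin_ext f p"])
      (auto simp: fun_eq_iff clinearD[OF clinear_bar_d2] bar_d2_single add.assoc)
  then show ?thesis by (simp add: lin_ext_def)
qed

lemma subspace_range:
  "clinear f \<Longrightarrow> complex_vector.subspace (range f)"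
  by (rule complex_vector_pair.linear_subspace_image) auto

lemma equivp_subspace:
  assumes W: "complex_vector.subspace W"
  shows "equivp (\<lambda>x y. x - y \<in> W)"
proof (rule equivpI)
  show "reflp (\<lambda>x y. x - y \<in> W)"
    by (rule reflpI) (simp add: complex_vector.subspace_0[OF W])
  show "symp (\<lambda>x y. x - y \<in> W)"
    by (rule sympI) (metis complex_vector.subspace_neg[OF W] minus_diff_eq)
  show "transp (\<lambda>x y. x - y \<in> W)"
  proof (rule transpI)
    fix x y z assume "x - y \<in> W" "y - z \<in> W"
    then have "(x - y) + (y - z) \<in> W" by (rule complex_vector.subspace_add[OF W])
    then show "x - z \<in> W" by simp
  qed
qed

lemma subspace_rel:
  assumes "complex_vector.subspace W"
  shows "a - b \<in> W \<Longrightarrow> c - d \<in> W \<Longrightarrow> (a + c) - (b + d) \<in> W"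
    "a - b \<in> W \<Longrightarrow> c - d \<in> W \<Longrightarrow> (a - c) - (b - d) \<in> W"
    "a - b \<in> W \<Longrightarrow> (- a) - (- b) \<in> W"
    "a - b \<in> W \<Longrightarrow> t *\<^sub>C a - t *\<^sub>C b \<in> W"
proof -
  show "a - b \<in> W \<Longrightarrow> c - d \<in> W \<Longrightarrow> (a + c) - (b + d) \<in> W"
    using complex_vector.subspace_add[OF assms, of "a - b" "c - d"] by (simp add: algebra_simps)
  show "a - b \<in> W \<Longrightarrow> c - d \<in> W \<Longrightarrow> (a - c) - (b - d) \<in> W"
    using complex_vector.subspace_diff[OF assms, of "a - b" "c - d"] by (simp add: algebra_simps)
  show "a - b \<in> W \<Longrightarrow> (- a) - (- b) \<in> W"
    using complex_vector.subspace_neg[OF assms, of "a - b"] by (simp add: algebra_simps)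
  show "a - b \<in> W \<Longrightarrow> t *\<^sub>C a - t *\<^sub>C b \<in> W"
    using complex_vector.subspace_scale[OF assms, of "a - b" t]
    by (simp add: complex_vector.scale_right_diff_distrib)
qed

quotient_type (overloaded) 'g H1 = "'g::group_add \<Rightarrow>\<^sub>0 complex" /
  "\<lambda>p q. p - q \<in> range bar_d2"
  by (rule equivp_subspace[OF subspace_range[OF clinear_bar_d2]])

quotient_type (overloaded) 'g H2 = "'g::group_add \<times> 'g \<Rightarrow>\<^sub>0 complex" /
  partial: "\<lambda>p q. bar_d2 p = 0 \<and> bar_d2 q = 0 \<and> p - q \<in> range bar_d3"
proof (rule part_equivpI)
  have "equivp (\<lambda>p q. p - q \<in> range bar_d3)"
    by (rule equivp_subspace[OF subspace_range[OF clinear_bar_d3]])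
  then have s: "symp (\<lambda>p q. p - q \<in> range bar_d3)" and t: "transp (\<lambda>p q. p - q \<in> range bar_d3)"
    by (auto elim: equivpE)
  show "\<exists>p. bar_d2 p = 0 \<and> bar_d2 p = 0 \<and> p - p \<in> range bar_d3"
    using clinearD(4)[OF clinear_bar_d2] clinearD(4)[OF clinear_bar_d3]
    by (metis cancel_comm_monoid_add_class.diff_cancel rangeI)
  show "symp (\<lambda>p q. bar_d2 p = 0 \<and> bar_d2 q = 0 \<and> p - q \<in> range bar_d3)"
    using s unfolding symp_def by blast
  show "transp (\<lambda>p q. bar_d2 p = 0 \<and> bar_d2 q = 0 \<and> p - q \<in> range bar_d3)"
    using t unfolding transp_def by blast
qed

instantiation H1 :: (group_add) complex_vector
begin
lift_definition zero_H1 :: "'a H1" is 0 .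
lift_definition plus_H1 :: "'a H1 \<Rightarrow> 'a H1 \<Rightarrow> 'a H1" is "(+)"
  by (rule subspace_rel[OF subspace_range[OF clinear_bar_d2]])
lift_definition minus_H1 :: "'a H1 \<Rightarrow> 'a H1 \<Rightarrow> 'a H1" is "(-)"
  by (rule subspace_rel[OF subspace_range[OF clinear_bar_d2]])
lift_definition uminus_H1 :: "'a H1 \<Rightarrow> 'a H1" is uminus
  by (rule subspace_rel[OF subspace_range[OF clinear_bar_d2]])
lift_definition scaleC_H1 :: "complex \<Rightarrow> 'a H1 \<Rightarrow> 'a H1" is scaleC
  by (rule subspace_rel[OF subspace_range[OF clinear_bar_d2]])
instance
  by standard
    (transfer; simp add: algebra_simps scaleC_add_right scaleC_add_left
      complex_vector.subspace_0[OF subspace_range[OF clinear_bar_d2]])+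
end

instantiation H2 :: (group_add) complex_vector
begin
lift_definition zero_H2 :: "'a H2" is 0
  by (simp add: clinearD[OF clinear_bar_d2]
      complex_vector.subspace_0[OF subspace_range[OF clinear_bar_d3]])
lift_definition plus_H2 :: "'a H2 \<Rightarrow> 'a H2 \<Rightarrow> 'a H2" is "(+)"
  by (elim conjE, intro conjI subspace_rel(1)[OF subspace_range[OF clinear_bar_d3]])
    (simp_all add: clinearD[OF clinear_bar_d2])
lift_definition minus_H2 :: "'a H2 \<Rightarrow> 'a H2 \<Rightarrow> 'a H2" is "(-)"
  by (elim conjE, intro conjI subspace_rel(2)[OF subspace_range[OF clinear_bar_d3]])
    (simp_all add: clinearD[OF clinear_bar_d2])
lift_definition uminus_H2 :: "'a H2 \<Rightarrow> 'a H2" is uminus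
  by (elim conjE, intro conjI subspace_rel(3)[OF subspace_range[OF clinear_bar_d3]])
    (simp_all add: clinearD[OF clinear_bar_d2])
lift_definition scaleC_H2 :: "complex \<Rightarrow> 'a H2 \<Rightarrow> 'a H2" is scaleC
  by (elim conjE, intro conjI subspace_rel(4)[OF subspace_range[OF clinear_bar_d3]])
    (simp_all add: clinearD[OF clinear_bar_d2])
instance
  by standard
    (transfer; simp add: algebra_simps scaleC_add_right scaleC_add_left clinearD[OF clinear_bar_d2]
      complex_vector.subspace_0[OF subspace_range[OF clinear_bar_d3]])+
end

lift_definition H1_class :: "'g::group_add \<Rightarrow> 'g H1" is "\<lambda>a. basis a" .


section \<open>Exterior powers\<close>

text \<open>
  \<open>\<Lambda>\<^sup>2V\<close> and \<open>\<Lambda>\<^sup>3V\<close> are the quotients of the free vector spaces on \<open>V\<^sup>2\<close> and \<open>V\<^sup>3\<close> by the relations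
  of multilinearity and alternation.
\<close>

inductive_set ext2_rels :: "('v::complex_vector \<times> 'v \<Rightarrow>\<^sub>0 complex) set" where
  "basis (u + u', v) - basis (u, v) - basis (u', v) \<in> ext2_rels"
| "basis (u, v + v') - basis (u, v) - basis (u, v') \<in> ext2_rels"
| "basis (t *\<^sub>C u, v) - t *\<^sub>C basis (u, v) \<in> ext2_rels"
| "basis (u, t *\<^sub>C v) - t *\<^sub>C basis (u, v) \<in> ext2_rels"
| "basis (u, u) \<in> ext2_rels"

inductive_set ext3_rels :: "('v::complex_vector \<times> 'v \<times> 'v \<Rightarrow>\<^sub>0 complex) set" where
  "basis (u + u', v, w) - basis (u, v, w) - basis (u', v, w) \<in> ext3_rels"
| "basis (u, v + v', w) - basis (u, v, w) - basis (u, v', w) \<in> ext3_rels"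
| "basis (u, v, w + w') - basis (u, v, w) - basis (u, v, w') \<in> ext3_rels"
| "basis (t *\<^sub>C u, v, w) - t *\<^sub>C basis (u, v, w) \<in> ext3_rels"
| "basis (u, t *\<^sub>C v, w) - t *\<^sub>C basis (u, v, w) \<in> ext3_rels"
| "basis (u, v, t *\<^sub>C w) - t *\<^sub>C basis (u, v, w) \<in> ext3_rels"
| "basis (u, u, w) \<in> ext3_rels"
| "basis (u, w, u) \<in> ext3_rels"
| "basis (w, u, u) \<in> ext3_rels"

quotient_type (overloaded) 'v ext2 = "'v::complex_vector \<times> 'v \<Rightarrow>\<^sub>0 complex" /
  "\<lambda>p q. p - q \<in> complex_vector.span ext2_rels"
  by (rule equivp_subspace[OF complex_vector.subspace_span])

quotient_type (overloaded) 'v ext3 = "'v::complex_vector \<times> 'v \<times> 'v \<Rightarrow>\<^sub>0 complex" /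
  "\<lambda>p q. p - q \<in> complex_vector.span ext3_rels"
  by (rule equivp_subspace[OF complex_vector.subspace_span])

instantiation ext2 :: (complex_vector) complex_vector
begin
lift_definition zero_ext2 :: "'a ext2" is 0 .
lift_definition plus_ext2 :: "'a ext2 \<Rightarrow> 'a ext2 \<Rightarrow> 'a ext2" is "(+)"
  by (rule subspace_rel[OF complex_vector.subspace_span])
lift_definition minus_ext2 :: "'a ext2 \<Rightarrow> 'a ext2 \<Rightarrow> 'a ext2" is "(-)"
  by (rule subspace_rel[OF complex_vector.subspace_span])
lift_definition uminus_ext2 :: "'a ext2 \<Rightarrow> 'a ext2" is uminus
  by (rule subspace_rel[OF complex_vector.subspace_span])
lift_definition scaleC_ext2 :: "complex \<Rightarrow> 'a ext2 \<Rightarrow> 'a ext2" is scaleC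
  by (rule subspace_rel[OF complex_vector.subspace_span])
instance
  by standard
    (transfer; simp add: algebra_simps scaleC_add_right scaleC_add_left complex_vector.span_zero)+
end

instantiation ext3 :: (complex_vector) complex_vector
begin
lift_definition zero_ext3 :: "'a ext3" is 0 .
lift_definition plus_ext3 :: "'a ext3 \<Rightarrow> 'a ext3 \<Rightarrow> 'a ext3" is "(+)"
  by (rule subspace_rel[OF complex_vector.subspace_span])
lift_definition minus_ext3 :: "'a ext3 \<Rightarrow> 'a ext3 \<Rightarrow> 'a ext3" is "(-)"
  by (rule subspace_rel[OF complex_vector.subspace_span])
lift_definition uminus_ext3 :: "'a ext3 \<Rightarrow> 'a ext3" is uminus
  by (rule subspace_rel[OF complex_vector.subspace_span])
lift_definition scaleC_ext3 :: "complex \<Rightarrow> 'a ext3 \<Rightarrow> 'a ext3" is scaleC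
  by (rule subspace_rel[OF complex_vector.subspace_span])
instance
  by standard
    (transfer; simp add: algebra_simps scaleC_add_right scaleC_add_left complex_vector.span_zero)+
end

lift_definition wedge2 :: "'v::complex_vector \<Rightarrow> 'v \<Rightarrow> 'v ext2" is
  "\<lambda>u v. basis (u, v)" .

lift_definition wedge3 :: "'v::complex_vector \<Rightarrow> 'v \<Rightarrow> 'v \<Rightarrow> 'v ext3" is
  "\<lambda>u v w. basis (u, v, w)" .

text \<open>The product \<open>V \<times> \<Lambda>\<^sup>2V \<rightarrow> \<Lambda>\<^sup>3V\<close>.\<close>

lift_definition wedge12 :: "'v::complex_vector \<Rightarrow> 'v ext2 \<Rightarrow> 'v ext3" is
  "\<lambda>x. lin_ext (\<lambda>(u, v). basis (x, u, v))"
proof -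
  fix x :: 'v and p q :: "'v \<times> 'v \<Rightarrow>\<^sub>0 complex"
  let ?f = "lin_ext (\<lambda>(u, v). basis (x, u, v))"
  have "?f r \<in> complex_vector.span ext3_rels" if "r \<in> ext2_rels" for r
    by (rule complex_vector.span_base)
      (use that in \<open>cases; simp add: lin_ext_simps ext3_rels.intros\<close>)
  then have *: "\<forall>r\<in>ext2_rels. ?f r \<in> complex_vector.span ext3_rels" by blast
  assume "p - q \<in> complex_vector.span ext2_rels"
  then have "?f (p - q) \<in> complex_vector.span ext3_rels"
    by (rule clinear_span_image[OF clinear_lin_ext *])
  then show "?f p - ?f q \<in> complex_vector.span ext3_rels"
    by (simp add: lin_ext_simps)
qed

text \<open>
  The value at \<open>w\<close> of the linear form on \<open>\<Lambda>\<^sup>2V\<close> induced by an alternating bilinear form \<open>B\<close>,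
  computed on a representative of \<open>w\<close>; see \<open>ext2_lift\<close> below.
\<close>

definition ext2_lift :: "('v::complex_vector \<Rightarrow> 'v \<Rightarrow> complex) \<Rightarrow> 'v ext2 \<Rightarrow> complex" where
  "ext2_lift B w = lin_ext (\<lambda>(u, v). B u v) (rep_ext2 w)"

definition wedge_form ::
  "('v::complex_vector \<Rightarrow> complex) \<Rightarrow> ('v \<Rightarrow> complex) \<Rightarrow> 'v ext2 \<Rightarrow> complex" where
  "wedge_form \<alpha> \<beta> = ext2_lift (\<lambda>u v. \<alpha> u * \<beta> v - \<alpha> v * \<beta> u)"

lemma wedge2_add: "wedge2 (u + u') v = wedge2 u v + wedge2 u' v"
    "wedge2 u (v + v') = wedge2 u v + wedge2 u v'"
  and wedge2_scale: "wedge2 (t *\<^sub>C u) v = t *\<^sub>C wedge2 u v"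
    "wedge2 u (t *\<^sub>C v) = t *\<^sub>C wedge2 u v"
  and wedge2_self: "wedge2 u u = 0"
  by (transfer;
      simp add: ext2_rels.intros[THEN complex_vector.span_base, unfolded diff_diff_eq])+

lemma wedge3_add: "wedge3 (u + u') v w = wedge3 u v w + wedge3 u' v w"
    "wedge3 u (v + v') w = wedge3 u v w + wedge3 u v' w"
    "wedge3 u v (w + w') = wedge3 u v w + wedge3 u v w'"
  and wedge3_scale: "wedge3 (t *\<^sub>C u) v w = t *\<^sub>C wedge3 u v w"
    "wedge3 u (t *\<^sub>C v) w = t *\<^sub>C wedge3 u v w"
    "wedge3 u v (t *\<^sub>C w) = t *\<^sub>C wedge3 u v w"
  and wedge3_self: "wedge3 u u w = 0" "wedge3 u w u = 0" "wedge3 w u u = 0"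
  by (transfer;
      simp add: ext3_rels.intros[THEN complex_vector.span_base, unfolded diff_diff_eq])+

lemma wedge12_wedge2: "wedge12 x (wedge2 u v) = wedge3 x u v"
  by transfer (simp add: scaleC_one complex_vector.span_zero)

lemma clinear_wedge12: "clinear (wedge12 x)"
  by (rule clinearI; transfer) (simp_all add: lin_ext_simps complex_vector.span_zero)

lemma lin_ext_fun:
  "lin_ext (\<lambda>x. f x + g x) p = lin_ext f p + lin_ext g p"
  "lin_ext (\<lambda>x. f x - g x) p = lin_ext f p - lin_ext g p"
  "lin_ext (\<lambda>x. c *\<^sub>C f x) p = c *\<^sub>C lin_ext f p"
  by (simp_all add: lin_ext_def complex_vector.scale_right_distrib sum.distrib sum_subtractf
      complex_vector.scale_right_diff_distrib complex_vector.scale_sum_right scaleC_scaleC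
      mult.commute)

lemma abs_ext2_eq: "abs_ext2 p = lin_ext (\<lambda>(u, v). wedge2 u v) p"
proof -
  have "clinear abs_ext2"
    by (rule clinearI) (simp_all add: plus_ext2.abs_eq scaleC_ext2.abs_eq)
  from lin_ext_mono[OF this, of basis p] show ?thesis
    by (simp add: lin_ext_basis wedge2_def case_prod_unfold)
qed

lemma abs_ext3_eq: "abs_ext3 p = lin_ext (\<lambda>(u, v, w). wedge3 u v w) p"
proof -
  have "clinear abs_ext3"
    by (rule clinearI) (simp_all add: plus_ext3.abs_eq scaleC_ext3.abs_eq)
  from lin_ext_mono[OF this, of basis p] show ?thesis
    by (simp add: lin_ext_basis wedge3_def case_prod_unfold)
qed

lemma abs_H1_eq: "abs_H1 p = lin_ext H1_class p"
proof -
  have "clinear abs_H1"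
    by (rule clinearI) (simp_all add: plus_H1.abs_eq scaleC_H1.abs_eq)
  from lin_ext_mono[OF this, of basis p] show ?thesis
    by (simp add: lin_ext_basis H1_class_def map_fun_def comp_def)
qed

lemma abs_rep_ext2: "abs_ext2 (rep_ext2 w) = w"
  by (rule Quotient_abs_rep[OF Quotient_ext2])

lemma abs_rep_ext3: "abs_ext3 (rep_ext3 w) = w"
  by (rule Quotient_abs_rep[OF Quotient_ext3])

lemma abs_rep_H1: "abs_H1 (rep_H1 w) = w"
  by (rule Quotient_abs_rep[OF Quotient_H1])

lemma ext2_lift_abs:
  assumes "\<And>u. clinear (B u)" "\<And>v. clinear (\<lambda>u. B u v)" "\<And>u. B u u = 0"
  shows "ext2_lift B (abs_ext2 p) = lin_ext (\<lambda>(u, v). B u v) p"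
proof -
  let ?f = "lin_ext (\<lambda>(u, v). B u v)"
  have "rep_ext2 (abs_ext2 p) - p \<in> complex_vector.span ext2_rels"
    using Quotient_rep_abs[OF Quotient_ext2, of p] by (simp add: complex_vector.span_zero)
  moreover have "\<forall>r\<in>ext2_rels. ?f r = 0"
  proof
    fix r :: "'a \<times> 'a \<Rightarrow>\<^sub>0 complex" assume "r \<in> ext2_rels"
    then show "?f r = 0"
      by cases (simp_all add: assms(3) lin_ext_simps clinearD[OF assms(1)] clinearD[OF assms(2)])
  qed
  ultimately have "?f (rep_ext2 (abs_ext2 p) - p) = 0"
    using clinear_span_zero[OF clinear_lin_ext] by blast
  then show ?thesis by (simp add: ext2_lift_def lin_ext_simps)
qed

lemma ext2_lift:
  assumes "\<And>u. clinear (B u)" "\<And>v. clinear (\<lambda>u. B u v)" "\<And>u. B u u = 0"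
  shows "clinear (ext2_lift B)" "ext2_lift B (wedge2 u v) = B u v"
proof -
  note abs = ext2_lift_abs[OF assms]
  show "clinear (ext2_lift B)"
  proof (rule clinearI)
    fix x y :: "'a ext2" and c :: complex
    show "ext2_lift B (x + y) = ext2_lift B x + ext2_lift B y"
      by (metis abs abs_rep_ext2 lin_ext_simps(1) plus_ext2.abs_eq)
    show "ext2_lift B (c *\<^sub>C x) = c *\<^sub>C ext2_lift B x"
      by (metis abs abs_rep_ext2 lin_ext_simps(3) scaleC_ext2.abs_eq)
  qed
  show "ext2_lift B (wedge2 u v) = B u v"
    unfolding wedge2_def by (simp add: abs)
qed

lemma wedge_form:
  assumes "clinear \<alpha>" "clinear \<beta>"
  shows "clinear (wedge_form \<alpha> \<beta>)"
    and "wedge_form \<alpha> \<beta> (wedge2 u v) = \<alpha> u * \<beta> v - \<alpha> v * \<beta> u"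
  unfolding wedge_form_def
  by (rule ext2_lift; (rule clinearI)?; simp add: clinearD[OF assms(1)] clinearD[OF assms(2)]
      algebra_simps)+

lemma wedge_form_separates:
  fixes w :: "'v::complex_vector ext2"
  assumes w: "\<And>\<alpha> \<beta>. clinear \<alpha> \<Longrightarrow> clinear \<beta> \<Longrightarrow> wedge_form \<alpha> \<beta> w = 0"
  shows "w = 0"
proof (rule ccontr)
  assume "w \<noteq> 0"
  then have "complex_vector.independent {w}" by simp
  from complex_vector_pair.linear_independent_extend[OF this, of "\<lambda>_. 1::complex"]
  obtain L :: "'v ext2 \<Rightarrow> complex" where L: "clinear L" "L w = 1" by auto
  define p where "p = rep_ext2 w"
  have wp: "w = lin_ext (\<lambda>(u, v). wedge2 u v) p"
    by (metis p_def abs_rep_ext2 abs_ext2_eq)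
  define E where "E = complex_vector.extend_basis ({} :: 'v set)"
  have E: "complex_vector.independent E" "complex_vector.span E = UNIV"
    unfolding E_def
    using complex_vector.independent_extend_basis complex_vector.span_extend_basis
      complex_vector.independent_empty by blast+
  define r where "r e v = complex_vector.representation E v e" for e v
  have r: "clinear (r e)" for e
    using complex_vector.linear_representation[OF E, of e]
    unfolding r_def scaleC_complex_def[abs_def] .
  define U where "U = fst ` Poly_Mapping.keys p \<union> snd ` Poly_Mapping.keys p"
  define F where "F = (\<Union>u\<in>U. {e. r e u \<noteq> 0})"
  have F: "finite F"
    unfolding F_def U_def r_def by (auto intro: complex_vector.finite_representation)
  have exp: "u = (\<Sum>e\<in>F. r e u *\<^sub>C e)" if "u \<in> U" for u
  proof -
    have "u = (\<Sum>e | r e u \<noteq> 0. r e u *\<^sub>C e)"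
      unfolding r_def by (rule complex_vector.sum_nonzero_representation_eq[symmetric])
        (use E in auto)
    also have "\<dots> = (\<Sum>e\<in>F. r e u *\<^sub>C e)"
      by (rule sum.mono_neutral_left) (use F that in \<open>auto simp: F_def\<close>)
    finally show ?thesis .
  qed
  have wl: "clinear (wedge2 u)" "clinear (\<lambda>u. wedge2 u v)" for u v :: 'v
    by (rule clinearI; simp add: wedge2_add wedge2_scale)+
  have B: "2 * L (wedge2 u v) =
      (\<Sum>e\<in>F. \<Sum>e'\<in>F. L (wedge2 e e') * wedge_form (r e) (r e') (wedge2 u v))"
    if "u \<in> U" "v \<in> U" for u v
  proof -
    have x: "L (wedge2 u v) = (\<Sum>e\<in>F. \<Sum>e'\<in>F. r e u * r e' v * L (wedge2 e e'))"
      if "u \<in> U" "v \<in> U" for u v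
      by (subst exp[OF that(1)], subst exp[OF that(2)])
        (simp add: clinearD[OF L(1)] clinearD[OF wl(1)] clinearD[OF wl(2)] sum_distrib_left
          mult.assoc, subst sum.swap, simp add: mult.left_commute)
    have "wedge2 (u + v) (u + v) = 0" by (rule wedge2_self)
    then have "wedge2 u v = - wedge2 v u"
      unfolding wedge2_add by (simp add: wedge2_self eq_neg_iff_add_eq_0 add.commute)
    then have "2 * L (wedge2 u v) = L (wedge2 u v) - L (wedge2 v u)"
      by (simp add: clinearD[OF L(1)])
    then show ?thesis
      unfolding x[OF that] x[OF that(2,1)]
      by (simp add: wedge_form r sum_subtractf[symmetric] algebra_simps)
  qed
  have "2 * L w = lin_ext (\<lambda>(u, v). 2 * L (wedge2 u v)) p"
    unfolding wp lin_ext_mono[OF L(1)]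
    by (simp add: lin_ext_def sum_distrib_left case_prod_unfold algebra_simps)
  also have "\<dots> = lin_ext (\<lambda>x.
      (\<Sum>e\<in>F. \<Sum>e'\<in>F. L (wedge2 e e') * wedge_form (r e) (r e') (wedge2 (fst x) (snd x)))) p"
    unfolding lin_ext_def
  proof (rule sum.cong)
    fix x assume "x \<in> Poly_Mapping.keys p"
    then have "fst x \<in> U" "snd x \<in> U" by (auto simp: U_def)
    from B[OF this] show "Poly_Mapping.lookup p x *\<^sub>C (case x of (u, v) \<Rightarrow> 2 * L (wedge2 u v)) =
      Poly_Mapping.lookup p x *\<^sub>C (\<Sum>e\<in>F. \<Sum>e'\<in>F.
        L (wedge2 e e') * wedge_form (r e) (r e') (wedge2 (fst x) (snd x)))"
      by (simp add: case_prod_unfold)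
  qed simp
  also have "\<dots> = (\<Sum>e\<in>F. \<Sum>e'\<in>F. L (wedge2 e e') * wedge_form (r e) (r e') w)"
  proof -
    have "wedge_form (r e) (r e') w =
        lin_ext (\<lambda>x. wedge_form (r e) (r e') (wedge2 (fst x) (snd x))) p" for e e'
      unfolding wp lin_ext_mono[OF wedge_form(1)[OF r r]] by (simp add: case_prod_unfold)
    then show ?thesis
      unfolding lin_ext_def
      by (simp add: sum_distrib_left sum.swap[of _ _ "Poly_Mapping.keys p"] algebra_simps)
  qed
  also have "\<dots> = 0" by (simp add: w r)
  finally show False using L by simp
qed


section \<open>Cup product and its dual\<close>

text \<open>
  \<open>H\<^sup>i(\<Gamma>, \<complex>)\<close> is identified with the linear forms on \<open>H\<^sub>i(\<Gamma>, \<complex>)\<close>. The cocycle \<open>\<Gamma> \<rightarrow> \<complex>\<close> of such a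
  form \<open>\<alpha>\<close> on \<open>H\<^sub>1\<close> is \<open>\<lambda>a. \<alpha> (H1_class a)\<close>, and \<open>\<alpha> \<union> \<beta>\<close> is represented by the cocycle
  \<open>(a, b) \<mapsto> \<alpha>(a) \<beta>(b)\<close>, here evaluated on a cycle representing the argument. The opposite sign
  convention for the cup product would replace \<open>cup_dual\<close> by its negative.

  \<open>cup_dual\<close> is the map \<open>c\<close> dual to the cup product. The fact \<open>cup_dual\<close> proves that it exists, and
  \<open>wedge_form_separates\<close> that it is unique.
\<close>

definition cup :: "('g::group_add H1 \<Rightarrow> complex) \<Rightarrow> ('g H1 \<Rightarrow> complex) \<Rightarrow> 'g H2 \<Rightarrow> complex" where
  "cup \<alpha> \<beta> y = lin_ext (\<lambda>(a, b). \<alpha> (H1_class a) * \<beta> (H1_class b)) (rep_H2 y)"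

definition cup_dual :: "'g::group_add H2 \<Rightarrow> 'g H1 ext2" where
  "cup_dual = (THE c. clinear c \<and>
     (\<forall>\<alpha> \<beta> y. clinear \<alpha> \<longrightarrow> clinear \<beta> \<longrightarrow> wedge_form \<alpha> \<beta> (c y) = cup \<alpha> \<beta> y))"

lemma H1_class_add: "H1_class (a + b) = H1_class a + H1_class b"
proof -
  have "basis (a + b) - (basis a + basis b) \<in> range bar_d2"
    by (rule range_eqI[where x = "- basis (a, b)"])
      (simp add: clinearD[OF clinear_bar_d2] bar_d2_single)
  then show ?thesis by transfer
qed

lemma H2_rel_refl:
  "bar_d2 p = 0 \<Longrightarrow> bar_d2 p = 0 \<and> bar_d2 p = 0 \<and> p - p \<in> range bar_d3"
  using complex_vector.subspace_0[OF subspace_range[OF clinear_bar_d3]] by simp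

lemma rep_H2_cycle: "bar_d2 (rep_H2 y) = 0"
  using Quotient_rep_reflp[OF Quotient_H2, of y] by blast

lemma abs_rep_H2: "abs_H2 (rep_H2 y) = y"
  by (rule Quotient_abs_rep[OF Quotient_H2])

lemma rep_abs_H2: "bar_d2 p = 0 \<Longrightarrow> rep_H2 (abs_H2 p) - p \<in> range bar_d3"
  using Quotient_rep_abs[OF Quotient_H2 H2_rel_refl] by blast

lemma plus_H2_abs:
  assumes "bar_d2 p = 0" "bar_d2 q = 0"
  shows "abs_H2 p + abs_H2 q = abs_H2 (p + q)"
  by (rule plus_H2.abs_eq; rule H2_rel_refl; rule assms)

lemma scaleC_H2_abs:
  assumes "bar_d2 p = 0"
  shows "t *\<^sub>C abs_H2 p = abs_H2 (t *\<^sub>C p)"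
  by (rule scaleC_H2.abs_eq; rule H2_rel_refl; rule assms)

text \<open>A biadditive map on \<open>\<Gamma>\<close> is a 2-cocycle.\<close>

lemma H2_lift:
  fixes h :: "'g::group_add \<Rightarrow> 'g \<Rightarrow> 'v::complex_vector"
  assumes h: "\<And>a b c. h (a + b) c = h a c + h b c" "\<And>a b c. h a (b + c) = h a b + h a c"
  defines "G \<equiv> lin_ext (\<lambda>(a, b). h a b)"
  shows "bar_d2 p = 0 \<Longrightarrow> G (rep_H2 (abs_H2 p)) = G p"
    and "clinear (\<lambda>y. G (rep_H2 y))"
proof -
  have G: "clinear G" by (simp add: G_def clinear_lin_ext)
  have "G (bar_d3 q) = lin_ext (\<lambda>x. 0) q" for q
    unfolding bar_d3_def lin_ext_mono[OF G]
    by (rule arg_cong[where f = "\<lambda>f. lin_ext f q"])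
      (auto simp: fun_eq_iff clinearD[OF G] h, simp add: G_def scaleC_one h)
  then have z: "G (bar_d3 q) = 0" for q by (simp add: lin_ext_def)
  show *: "G (rep_H2 (abs_H2 p)) = G p" if "bar_d2 p = 0" for p
    using rep_abs_H2[OF that] z clinearD(2)[OF G, of "rep_H2 (abs_H2 p)" p]
    by (metis imageE right_minus_eq)
  show "clinear (\<lambda>y. G (rep_H2 y))"
  proof (rule clinearI)
    fix x y :: "'g H2" and t :: complex
    have "G (rep_H2 (abs_H2 (rep_H2 x) + abs_H2 (rep_H2 y))) = G (rep_H2 x + rep_H2 y)"
      by (simp add: plus_H2_abs rep_H2_cycle * clinearD[OF clinear_bar_d2])
    then show "G (rep_H2 (x + y)) = G (rep_H2 x) + G (rep_H2 y)"
      by (simp add: abs_rep_H2 clinearD[OF G])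
    have "G (rep_H2 (t *\<^sub>C abs_H2 (rep_H2 x))) = G (t *\<^sub>C rep_H2 x)"
      by (simp add: scaleC_H2_abs rep_H2_cycle * clinearD[OF clinear_bar_d2])
    then show "G (rep_H2 (t *\<^sub>C x)) = t *\<^sub>C G (rep_H2 x)"
      by (simp add: abs_rep_H2 clinearD[OF G])
  qed
qed

lemma cup:
  assumes "clinear \<alpha>" "clinear \<beta>"
  shows "bar_d2 p = 0 \<Longrightarrow>
      cup \<alpha> \<beta> (abs_H2 p) = lin_ext (\<lambda>(a, b). \<alpha> (H1_class a) * \<beta> (H1_class b)) p"
    and "clinear (cup \<alpha> \<beta>)"
  unfolding cup_def
  by (rule H2_lift[of "\<lambda>a b. \<alpha> (H1_class a) * \<beta> (H1_class b)"]; simp add: H1_class_add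
      clinearD[OF assms(1)] clinearD[OF assms(2)] algebra_simps)+

lemma cup_dual_formula:
  fixes y :: "'g::group_add H2"
  assumes \<alpha>: "clinear \<alpha>" and \<beta>: "clinear \<beta>"
  shows "wedge_form \<alpha> \<beta>
      ((1/2) *\<^sub>C lin_ext (\<lambda>(a, b). wedge2 (H1_class a) (H1_class b)) (rep_H2 y)) = cup \<alpha> \<beta> y"
proof -
  let ?p = "rep_H2 y"
  let ?a = "\<lambda>x. \<alpha> (H1_class x)" and ?b = "\<lambda>x. \<beta> (H1_class x)"
  let ?f = "lin_ext (\<lambda>x. ?a x * ?b x)"
  have f: "clinear ?f" by (rule clinear_lin_ext)
  have "?f (bar_d2 ?p) = lin_ext (\<lambda>(a, b). - (?a a * ?b b + ?a b * ?b a)) ?p"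
    unfolding bar_d2_def lin_ext_mono[OF f]
    by (rule arg_cong[where f = "\<lambda>f. lin_ext f ?p"])
      (auto simp: fun_eq_iff clinearD[OF f] H1_class_add clinearD[OF \<alpha>] clinearD[OF \<beta>]
        algebra_simps)
  then have "lin_ext (\<lambda>(a, b). - (?a a * ?b b + ?a b * ?b a)) ?p = 0"
    by (simp add: rep_H2_cycle clinearD[OF f])
  then have "- (lin_ext (\<lambda>(a, b). ?a a * ?b b) ?p + lin_ext (\<lambda>(a, b). ?a b * ?b a) ?p) = 0"
    by (simp add: lin_ext_def case_prod_unfold distrib_left sum_subtractf sum_negf
        right_diff_distrib)
  then have s: "lin_ext (\<lambda>(a, b). ?a b * ?b a) ?p = - lin_ext (\<lambda>(a, b). ?a a * ?b b) ?p"
    by (simp only: neg_equal_0_iff_equal eq_neg_iff_add_eq_0 add.commute)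
  note W = wedge_form(1)[OF \<alpha> \<beta>]
  have "wedge_form \<alpha> \<beta>
      ((1/2) *\<^sub>C lin_ext (\<lambda>(a, b). wedge2 (H1_class a) (H1_class b)) ?p) =
      (1/2) * lin_ext (\<lambda>(a, b). ?a a * ?b b - ?a b * ?b a) ?p"
    unfolding clinearD(3)[OF W] lin_ext_mono[OF W]
    by (simp add: case_prod_unfold wedge_form \<alpha> \<beta>)
  also have "\<dots> = lin_ext (\<lambda>(a, b). ?a a * ?b b) ?p"
    using s by (simp add: lin_ext_fun case_prod_unfold)
  finally show ?thesis by (simp add: cup_def)
qed

lemma cup_dual:
  fixes y :: "'g::group_add H2"
  shows "clinear (cup_dual :: 'g H2 \<Rightarrow> 'g H1 ext2)"
    "clinear \<alpha> \<Longrightarrow> clinear \<beta> \<Longrightarrow> wedge_form \<alpha> \<beta> (cup_dual y) = cup \<alpha> \<beta> y"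
    "cup_dual y = (1/2) *\<^sub>C lin_ext (\<lambda>(a, b). wedge2 (H1_class a) (H1_class b)) (rep_H2 y)"
proof -
  define C where "C y = (1/2) *\<^sub>C lin_ext (\<lambda>(a, b). wedge2 (H1_class a) (H1_class b)) (rep_H2 y)"
    for y :: "'g H2"
  have l: "clinear (\<lambda>y :: 'g H2. lin_ext (\<lambda>(a, b). wedge2 (H1_class a) (H1_class b)) (rep_H2 y))"
    by (rule H2_lift) (simp_all add: H1_class_add wedge2_add)
  have C: "clinear C"
    unfolding C_def
    by (intro clinearI) (simp_all add: clinearD[OF l] complex_vector.scale_right_distrib mult.commute)
  have *: "cup_dual = C"
    unfolding cup_dual_def
  proof (rule the_equality)
    show "clinear C \<and>
      (\<forall>\<alpha> \<beta> y. clinear \<alpha> \<longrightarrow> clinear \<beta> \<longrightarrow> wedge_form \<alpha> \<beta> (C y) = cup \<alpha> \<beta> y)"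
      using C cup_dual_formula unfolding C_def by blast
    fix c :: "'g H2 \<Rightarrow> 'g H1 ext2"
    assume c: "clinear c \<and>
      (\<forall>\<alpha> \<beta> y. clinear \<alpha> \<longrightarrow> clinear \<beta> \<longrightarrow> wedge_form \<alpha> \<beta> (c y) = cup \<alpha> \<beta> y)"
    have "c y - C y = 0" for y
    proof (rule wedge_form_separates)
      fix \<alpha> \<beta> :: "'g H1 \<Rightarrow> complex" assume *: "clinear \<alpha>" "clinear \<beta>"
      then have "wedge_form \<alpha> \<beta> (c y) = wedge_form \<alpha> \<beta> (C y)"
        using c unfolding C_def cup_dual_formula[OF *] by blast
      then show "wedge_form \<alpha> \<beta> (c y - C y) = 0"
        by (simp add: clinearD[OF wedge_form(1)[OF *]])
    qed
    then show "c = C" by (auto simp: fun_eq_iff)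
  qed
  show "clinear (cup_dual :: 'g H2 \<Rightarrow> 'g H1 ext2)" using C * by simp
  show "cup_dual y = (1/2) *\<^sub>C lin_ext (\<lambda>(a, b). wedge2 (H1_class a) (H1_class b)) (rep_H2 y)"
    by (simp add: * C_def)
  show "clinear \<alpha> \<Longrightarrow> clinear \<beta> \<Longrightarrow> wedge_form \<alpha> \<beta> (cup_dual y) = cup \<alpha> \<beta> y"
    using cup_dual_formula by (simp add: * C_def)
qed


section \<open>Functions satisfying the parallelogram identity\<close>

definition parallelogram_functions :: "('g::group_add \<Rightarrow> complex) set" where
  "parallelogram_functions = {f. \<forall>x y. f (x + y) + f (x - y) = 2 * f x + 2 * f y}"

text \<open>
  \<open>lin_ext f\<close> is the linear extension of \<open>f\<close> to the group algebra. The facts \<open>para_third_swap\<close>,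
  \<open>para_third_add\<close> and \<open>para_third_add'\<close> state that the form in \<open>\<gamma>\<^sub>1, \<gamma>\<^sub>2, \<gamma>\<^sub>3\<close> is alternating and a
  morphism in each variable, \<open>epsilon3_star\<close> that the induced form exists, and \<open>ext3_H1_eqI\<close> that it
  is unique.
\<close>

definition epsilon3_star :: "('g::group_add \<Rightarrow> complex) \<Rightarrow> 'g H1 ext3 \<Rightarrow> complex" where
  "epsilon3_star f = (THE \<Phi>. clinear \<Phi> \<and>
     (\<forall>a b c. \<Phi> (wedge3 (H1_class a) (H1_class b) (H1_class c)) =
        lin_ext f ((basis a - 1) * (basis b - 1) * (basis c - 1))))"

definition E_space :: "('g::group_add H1 ext3 \<Rightarrow> complex) set" where
  "E_space = {\<Phi>. clinear \<Phi> \<and> (\<forall>x. \<forall>y :: 'g H2. \<Phi> (wedge12 x (cup_dual y)) = 0)}"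

lemma third_difference:
  "lin_ext f ((basis a - 1) * (basis b - 1) * (basis c - 1)) =
    f (a + b + c) - f (a + b) - f (b + c) - f (a + c) + f a + f b + f c - f 0"
proof -
  have "(basis a - 1) * (basis b - 1) * (basis c - 1) = basis (a + b + c) - basis (a + b)
      - basis (b + c) - basis (a + c) + basis a + basis b + basis c - basis 0"
    by (simp add: algebra_simps mult_single)
  then show ?thesis by (simp add: lin_ext_simps del: single_one)
qed

context
  fixes f :: "'g::group_add \<Rightarrow> complex" and T :: "'g \<Rightarrow> 'g \<Rightarrow> 'g \<Rightarrow> complex"
  assumes f: "f \<in> parallelogram_functions"
  defines "T \<equiv> \<lambda>a b c. lin_ext f ((basis a - 1) * (basis b - 1) * (basis c - 1))"
begin

lemma para: "f (x - y) = 2 * f x + 2 * f y - f (x + y)"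
  using f by (simp add: parallelogram_functions_def eq_diff_eq add.commute)

lemma para_0: "f 0 = 0"
  using para[of 0 0] by simp

lemma para_minus: "f (- x) = f x"
  using para[of 0 x] by (simp add: para_0)

lemma para_comm: "f (x + y) = f (y + x)"
proof -
  have "f (x - y) = f (y - x)" using para_minus[of "x - y"] by simp
  then show ?thesis by (simp add: para add.commute)
qed

lemma para_third: "T a b c = f (a + b + c) - f (a + b) - f (b + c) - f (a + c) + f a + f b + f c"
  by (simp add: T_def third_difference para_0)

lemma para_third_cyc: "T a b c = T b c a"
  using para_comm[of a "b + c"] para_comm[of a b] para_comm[of a c]
  by (simp add: para_third add.assoc)

lemma para_third_odd: "T a b (- c) = - T a b c"
  using para[of "a + b" c] para[of a c] para[of b c] by (simp add: para_third para_minus)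

lemma para_third_swap13: "T c b a = - T a b c"
proof -
  have "T c b a = T (- a) (- b) (- c)"
    using para_minus[of "c + b + a"] para_minus[of "c + b"] para_minus[of "b + a"]
      para_minus[of "c + a"]
    by (simp add: para_third para_minus minus_add add.assoc)
  also have "\<dots> = - T a b c"
    by (metis para_third_odd para_third_cyc minus_minus)
  finally show ?thesis .
qed

lemma para_third_swap: "T b a c = - T a b c" "T a c b = - T a b c"
  by (metis para_third_cyc para_third_swap13)+

lemma para_third_add: "T a b (c + d) = T a b c + T a b d"
proof -
  define D where "D a b c d = T a b (c + d) - T a b c - T a b d" for a b c d
  have D1: "D a b c d = T (a + b) c d - T a c d - T b c d" for a b c d
    by (simp add: D_def para_third add.assoc)
  have D2: "D a b c d = T a (b + c) d - T a b d - T a c d" for a b c d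
    by (simp add: D_def para_third add.assoc)
  have s12: "D b a c d = - D a b c d" for a b c d
    by (simp add: D_def para_third_swap(1)[of b a])
  have s34: "D a b d c = - D a b c d" for a b c d
    by (simp add: D1 para_third_swap(2)[of _ d c])
  have s14: "D d b c a = - D a b c d" for a b c d
    by (simp add: D2 para_third_swap13[of d _ a])
  have cyc: "D b c d a = D a b c d"
    using para_comm[of a "b + c + d"] para_comm[of a "c + d"] para_comm[of a "b + c"]
      para_comm[of a "b + d"] para_comm[of a b] para_comm[of a c] para_comm[of a d]
    by (simp add: D_def para_third add.assoc)
  have "D b c d a = - D a b c d"
    by (metis s12 s34 s14 minus_minus)
  with cyc have "D a b c d = 0" by simp
  then show ?thesis by (simp add: D_def diff_diff_eq)
qed

lemma para_third_add': "T (a + b) c d = T a c d + T b c d" "T a (b + c) d = T a b d + T a c d"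
  by (metis para_third_cyc para_third_add)+

end

text \<open>The linear map on \<open>H\<^sub>1\<close> induced by a morphism on \<open>\<Gamma>\<close>.\<close>

definition H1_lift :: "('g::group_add \<Rightarrow> 'v::complex_vector) \<Rightarrow> 'g H1 \<Rightarrow> 'v" where
  "H1_lift h u = lin_ext h (rep_H1 u)"

lemma H1_lift:
  fixes h :: "'g::group_add \<Rightarrow> 'v::complex_vector"
  assumes h: "\<And>a b. h (a + b) = h a + h b"
  shows "clinear (H1_lift h)" "H1_lift h (H1_class a) = h a"
proof -
  let ?G = "lin_ext h"
  note G = clinear_lin_ext[of h]
  have "?G (bar_d2 q) = lin_ext (\<lambda>x. 0) q" for q
    unfolding bar_d2_def lin_ext_mono[OF G]
    by (rule arg_cong[where f = "\<lambda>f. lin_ext f q"])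
      (auto simp: fun_eq_iff clinearD[OF G] h scaleC_one)
  then have z: "?G (bar_d2 q) = 0" for q by (simp add: lin_ext_def)
  have abs: "H1_lift h (abs_H1 p) = ?G p" for p
  proof -
    have "rep_H1 (abs_H1 p) - p \<in> range bar_d2"
      using Quotient_rep_abs[OF Quotient_H1, of p]
      by (simp add: complex_vector.subspace_0[OF subspace_range[OF clinear_bar_d2]])
    then show ?thesis
      using z clinearD(2)[OF G, of "rep_H1 (abs_H1 p)" p]
      unfolding H1_lift_def by (metis imageE right_minus_eq)
  qed
  show "clinear (H1_lift h)"
  proof (rule clinearI)
    fix x y :: "'g H1" and c :: complex
    show "H1_lift h (x + y) = H1_lift h x + H1_lift h y"
      by (metis abs abs_rep_H1 lin_ext_simps(1) plus_H1.abs_eq)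
    show "H1_lift h (c *\<^sub>C x) = c *\<^sub>C H1_lift h x"
      by (metis abs abs_rep_H1 lin_ext_simps(3) scaleC_H1.abs_eq)
  qed
  show "H1_lift h (H1_class a) = h a"
    unfolding H1_class_def by (simp add: abs scaleC_one)
qed

lemma H1_lift_fun:
  "H1_lift (\<lambda>a. f a + g a) u = H1_lift f u + H1_lift g u"
  "H1_lift (\<lambda>a. c *\<^sub>C f a) u = c *\<^sub>C H1_lift f u"
  by (simp_all only: H1_lift_def lin_ext_fun)

lemma H1_eqI:
  assumes "clinear F" "clinear G" "\<And>a. F (H1_class a) = G (H1_class a)"
  shows "F u = G u"
proof -
  have "u = lin_ext H1_class (rep_H1 u)"
    by (metis abs_rep_H1 abs_H1_eq)
  then show ?thesis
    by (metis (no_types, lifting) lin_ext_mono[OF assms(1)] lin_ext_mono[OF assms(2)] assms(3)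
        lin_ext_def sum.cong)
qed

lemma ext3_lift:
  fixes B :: "'v::complex_vector \<Rightarrow> 'v \<Rightarrow> 'v \<Rightarrow> complex"
  assumes B: "\<And>u v. clinear (B u v)" "\<And>u w. clinear (\<lambda>v. B u v w)" "\<And>v w. clinear (\<lambda>u. B u v w)"
    "\<And>u w. B u u w = 0" "\<And>u w. B u w u = 0" "\<And>u w. B w u u = 0"
  obtains \<Phi> where "clinear \<Phi>" "\<And>u v w. \<Phi> (wedge3 u v w) = B u v w"
proof -
  let ?f = "lin_ext (\<lambda>(u, v, w). B u v w)"
  define \<Phi> where "\<Phi> x = ?f (rep_ext3 x)" for x
  have abs: "\<Phi> (abs_ext3 p) = ?f p" for p
  proof -
    have "rep_ext3 (abs_ext3 p) - p \<in> complex_vector.span ext3_rels"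
      using Quotient_rep_abs[OF Quotient_ext3, of p] by (simp add: complex_vector.span_zero)
    moreover have "\<forall>r\<in>ext3_rels. ?f r = 0"
    proof
      fix r :: "'v \<times> 'v \<times> 'v \<Rightarrow>\<^sub>0 complex" assume "r \<in> ext3_rels"
      then show "?f r = 0"
        by cases (simp_all add: B(4-6) lin_ext_simps clinearD[OF B(1)] clinearD[OF B(2)]
            clinearD[OF B(3)])
    qed
    ultimately have "?f (rep_ext3 (abs_ext3 p) - p) = 0"
      using clinear_span_zero[OF clinear_lin_ext] by blast
    then show ?thesis by (simp add: \<Phi>_def lin_ext_simps)
  qed
  show thesis
  proof (rule that)
    show "clinear \<Phi>"
    proof (rule clinearI)
      fix x y :: "'v ext3" and c :: complex
      show "\<Phi> (x + y) = \<Phi> x + \<Phi> y"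
        by (metis abs abs_rep_ext3 lin_ext_simps(1) plus_ext3.abs_eq)
      show "\<Phi> (c *\<^sub>C x) = c *\<^sub>C \<Phi> x"
        by (metis abs abs_rep_ext3 lin_ext_simps(3) scaleC_ext3.abs_eq)
    qed
    show "\<Phi> (wedge3 u v w) = B u v w" for u v w
      unfolding wedge3_def by (simp add: abs)
  qed
qed

lemma clinear_wedge3:
  "clinear (wedge3 u v)" "clinear (\<lambda>v. wedge3 u v w)" "clinear (\<lambda>u. wedge3 u v w)"
  by (rule clinearI; simp add: wedge3_add wedge3_scale)+

lemma ext3_H1_eqI:
  fixes \<Phi> \<Psi> :: "'g::group_add H1 ext3 \<Rightarrow> complex"
  assumes \<Phi>: "clinear \<Phi>" and \<Psi>: "clinear \<Psi>"
    and eq: "\<And>a b c. \<Phi> (wedge3 (H1_class a) (H1_class b) (H1_class c)) =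
      \<Psi> (wedge3 (H1_class a) (H1_class b) (H1_class c))"
  shows "\<Phi> = \<Psi>"
proof
  note lin = clinearD[OF \<Phi>] clinearD[OF \<Psi>] clinearD[OF clinear_wedge3(1)]
    clinearD[OF clinear_wedge3(2)] clinearD[OF clinear_wedge3(3)]
  have 1: "\<Phi> (wedge3 (H1_class a) (H1_class b) w) = \<Psi> (wedge3 (H1_class a) (H1_class b) w)"
    for a b w
    by (rule H1_eqI[where u = w]) (auto intro!: clinearI simp: lin eq)
  have 2: "\<Phi> (wedge3 (H1_class a) v w) = \<Psi> (wedge3 (H1_class a) v w)" for a v w
    by (rule H1_eqI[where u = v]) (auto intro!: clinearI simp: lin 1)
  have 3: "\<Phi> (wedge3 u v w) = \<Psi> (wedge3 u v w)" for u v w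
    by (rule H1_eqI[where u = u]) (auto intro!: clinearI simp: lin 2)
  fix x :: "'g H1 ext3"
  have x: "x = lin_ext (\<lambda>(u, v, w). wedge3 u v w) (rep_ext3 x)"
    by (metis abs_rep_ext3 abs_ext3_eq)
  have "\<Phi> (lin_ext (\<lambda>(u, v, w). wedge3 u v w) p) = \<Psi> (lin_ext (\<lambda>(u, v, w). wedge3 u v w) p)" for p
    unfolding lin_ext_mono[OF \<Phi>] lin_ext_mono[OF \<Psi>] by (simp add: case_prod_unfold 3)
  with x show "\<Phi> x = \<Psi> x" by metis
qed

lemma epsilon3_star:
  fixes f :: "'g::group_add \<Rightarrow> complex"
  assumes f: "f \<in> parallelogram_functions"
  shows "clinear (epsilon3_star f)"
    and "epsilon3_star f (wedge3 (H1_class a) (H1_class b) (H1_class c)) =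
      lin_ext f ((basis a - 1) * (basis b - 1) * (basis c - 1))"
proof -
  define T where "T a b c = lin_ext f ((basis a - 1) * (basis b - 1) * (basis c - 1))" for a b c
  note Ta = para_third_add[OF f, folded T_def] para_third_add'[OF f, folded T_def]
  note Ts = para_third_swap[OF f, folded T_def]
  define I where "I a b = H1_lift (T a b)" for a b
  have I: "clinear (I a b)" "I a b (H1_class c) = T a b c" for a b c
    using H1_lift[of "T a b", OF Ta(1)] by (simp_all only: I_def)
  have Ia: "I (a + a') b w = I a b w + I a' b w" "I a (b + b') w = I a b w + I a b' w" for a a' b b' w
    by (simp_all only: I_def H1_lift_fun[symmetric] Ta[symmetric])
  define J where "J a v w = H1_lift (\<lambda>b. I a b w) v" for a v w
  have J: "clinear (\<lambda>v. J a v w)" "J a (H1_class b) w = I a b w" for a b w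
    using H1_lift[of "\<lambda>b. I a b w", OF Ia(2)] by (simp_all only: J_def)
  have Jl: "clinear (J a v)" for a v
    by (rule clinearI) (simp_all only: J_def clinearD[OF I(1)] H1_lift_fun)
  have Ja: "J (a + a') v w = J a v w + J a' v w" for a a' v w
    by (simp only: J_def Ia H1_lift_fun)
  define M where "M u v w = H1_lift (\<lambda>a. J a v w) u" for u v w
  have M3: "clinear (\<lambda>u. M u v w)" "M (H1_class a) v w = J a v w" for a v w
    using H1_lift[of "\<lambda>a. J a v w", OF Ja] by (simp_all only: M_def)
  have M1: "clinear (M u v)" for u v
    by (rule clinearI) (simp_all only: M_def clinearD[OF Jl] H1_lift_fun)
  have M2: "clinear (\<lambda>v. M u v w)" for u w
    by (rule clinearI) (simp_all only: M_def clinearD[OF J(1)] H1_lift_fun)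
  note M = M1 M2 M3
  note lin = clinearD[OF M(1)] clinearD[OF M(2)] clinearD[OF M(3)]
  have MT: "M (H1_class a) (H1_class b) (H1_class c) = T a b c" for a b c
    by (simp add: M J I)
  have sw1: "M v u w = - M u v w" for u v w
  proof -
    have 1: "M (H1_class b) (H1_class a) w = - M (H1_class a) (H1_class b) w" for a b w
      by (rule H1_eqI[where u = w]) (auto intro!: clinearI simp: lin MT Ts(1)[of b a])
    have 2: "M v (H1_class a) w = - M (H1_class a) v w" for a v w
      by (rule H1_eqI[where u = v]) (auto intro!: clinearI simp: lin 1[of _ a])
    show ?thesis
      by (rule H1_eqI[where u = u]) (auto intro!: clinearI simp: lin 2)
  qed
  have sw2: "M u w v = - M u v w" for u v w
  proof -
    have 1: "M (H1_class a) w (H1_class b) = - M (H1_class a) (H1_class b) w" for a b w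
      by (rule H1_eqI[where u = w]) (auto intro!: clinearI simp: lin MT Ts(2)[of a _ b])
    have 2: "M (H1_class a) w v = - M (H1_class a) v w" for a v w
      by (rule H1_eqI[where u = v]) (auto intro!: clinearI simp: lin 1)
    show ?thesis
      by (rule H1_eqI[where u = u]) (auto intro!: clinearI simp: lin 2[of _ w])
  qed
  have "M u u w = 0" "M u w u = 0" "M w u u = 0" for u w
    using sw1[of u u w] sw2[of w u u] sw2[of u w u] by simp_all
  from ext3_lift[of M, OF M(1-3) this] obtain \<Phi> where \<Phi>: "clinear \<Phi>" "\<And>u v w. \<Phi> (wedge3 u v w) = M u v w"
    by blast
  have "epsilon3_star f = \<Phi>"
    unfolding epsilon3_star_def
    by (rule the_equality) (use \<Phi> MT T_def in \<open>auto intro: ext3_H1_eqI\<close>)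
  then show "clinear (epsilon3_star f)"
    and "epsilon3_star f (wedge3 (H1_class a) (H1_class b) (H1_class c)) =
      lin_ext f ((basis a - 1) * (basis b - 1) * (basis c - 1))"
    using \<Phi> MT T_def by simp_all
qed

end

theory Submission
  imports Defs
begin

text \<open>
  Write \<open>T a b c\<close> for \<open>\<Phi> (a \<and> b \<and> c)\<close>, where \<open>\<Phi>\<close> is a linear form on \<open>\<Lambda>\<^sup>3H\<^sub>1\<close> and \<open>a, b, c\<close> are
  classes of group elements. The form \<open>\<Phi>\<close> lies in \<open>\<E>(\<Gamma>)\<close> iff for each \<open>x\<close> the 2-cocycle
  \<open>(a, b) \<mapsto> T x a b\<close> vanishes on all 2-cycles (\<open>E_space_iff\<close>), which over a field means that it is a
  coboundary. So the theorem compares \<open>\<P>(\<Gamma>)\<close> with families of 1-cochains \<open>h x\<close> satisfying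
  \<open>h x (a + b) = h x a + h x b + T x a b\<close>.

  For \<open>f\<close> in \<open>\<P>(\<Gamma>)\<close>, the third difference of \<open>f\<close> in \<open>a, b, x\<close> is, up to sign, the coboundary
  of \<open>a \<mapsto> f (a + x) - f a - f x\<close>, so \<open>\<epsilon>\<^sub>3\<^sup>*(f)\<close> lies in \<open>\<E>(\<Gamma>)\<close> (\<open>epsilon3_star_in_E_space\<close>).

  Conversely, let \<open>\<Phi>\<close> be in \<open>\<E>(\<Gamma>)\<close>. A linear generalised inverse of the differential of degree 2
  makes a choice of the cochains \<open>h x\<close> that is additive in \<open>x\<close> (\<open>E_space_cochains\<close>). The solution is
  the diagonal \<open>f x = h x x\<close> (\<open>diagonal_parallelogram\<close>, \<open>diagonal_third_difference\<close>). To see where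
  it comes from, compare the two sides for a given solution \<open>f\<close>: its second difference
  \<open>f (x + y) - f x - f y\<close> must be \<open>h x y + h y x\<close> up to a symmetric biadditive form, and such a form
  is always a second difference. Now \<open>F x y = h x y + h y x\<close> is a 2-cocycle invariant under
  \<open>(x, y) \<mapsto> (- y, - x)\<close>. Hence the central extension of \<open>\<Gamma>\<close> by \<open>\<complex>\<close> that it defines has an
  automorphism that lifts the identity of \<open>\<Gamma>\<close> and is \<open>- 1\<close> on \<open>\<complex>\<close>, so that \<open>2F\<close> is a coboundary;
  the primitive of \<open>F\<close> given by this automorphism is \<open>- F x (- x) / 2 = h x x\<close>.
\<close>

lemma lin_ext_bar_d2:
  "lin_ext g (bar_d2 p) = lin_ext (\<lambda>(a, b). g b - g (a + b) + g a) p"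
  unfolding bar_d2_def lin_ext_mono[OF clinear_lin_ext]
  by (rule arg_cong[where f = "\<lambda>f. lin_ext f p"])
    (auto simp: fun_eq_iff lin_ext_simps scaleC_one)

lemma cup_dual_abs:
  assumes "bar_d2 p = 0"
  shows "cup_dual (abs_H2 p) = (1/2) *\<^sub>C lin_ext (\<lambda>(a, b). wedge2 (H1_class a) (H1_class b)) p"
  unfolding cup_dual(3)
  by (subst H2_lift(1)[of "\<lambda>a b. wedge2 (H1_class a) (H1_class b)"])
    (simp_all add: H1_class_add wedge2_add assms)

lemma E_space_iff:
  "\<Phi> \<in> E_space \<longleftrightarrow> clinear \<Phi> \<and> (\<forall>u p. bar_d2 p = 0 \<longrightarrow>
     lin_ext (\<lambda>(a, b). \<Phi> (wedge3 u (H1_class a) (H1_class b))) p = 0)"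
proof (cases "clinear \<Phi>")
  case True
  have *: "\<Phi> (wedge12 u (cup_dual (abs_H2 p))) =
      (1/2) * lin_ext (\<lambda>(a, b). \<Phi> (wedge3 u (H1_class a) (H1_class b))) p"
    if "bar_d2 p = 0" for u p
    unfolding cup_dual_abs[OF that] clinearD(3)[OF clinear_wedge12] clinearD(3)[OF True]
      lin_ext_mono[OF clinear_wedge12] lin_ext_mono[OF True]
    by (simp add: case_prod_unfold wedge12_wedge2)
  have "(\<forall>u y. \<Phi> (wedge12 u (cup_dual y)) = 0) \<longleftrightarrow>
      (\<forall>u p. bar_d2 p = 0 \<longrightarrow> \<Phi> (wedge12 u (cup_dual (abs_H2 p))) = 0)"
    by (metis abs_rep_H2 rep_H2_cycle)
  then show ?thesis
    using True by (simp add: E_space_def *)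
qed (simp add: E_space_def)

lemma epsilon3_star_in_E_space:
  fixes f :: "'g::group_add \<Rightarrow> complex"
  assumes f: "f \<in> parallelogram_functions"
  shows "epsilon3_star f \<in> E_space"
  unfolding E_space_iff
proof (intro conjI allI impI)
  let ?\<Phi> = "epsilon3_star f"
  show lin: "clinear ?\<Phi>" by (rule epsilon3_star(1)[OF f])
  fix u :: "'g H1" and p :: "'g \<times> 'g \<Rightarrow>\<^sub>0 complex"
  assume p: "bar_d2 p = 0"
  let ?L = "\<lambda>u. lin_ext (\<lambda>(a, b). ?\<Phi> (wedge3 u (H1_class a) (H1_class b))) p"
  have L: "clinear ?L"
    by (rule clinearI)
      (simp_all add: case_prod_unfold wedge3_add wedge3_scale clinearD[OF lin] lin_ext_fun
        del: scaleC_complex_def)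
  have "?L (H1_class x) = 0" for x
  proof -
    let ?g = "\<lambda>a. f (a + x) - f a - f x"
    have "?\<Phi> (wedge3 (H1_class x) (H1_class a) (H1_class b)) = - (?g b - ?g (a + b) + ?g a)"
      for a b
      unfolding epsilon3_star(2)[OF f] para_third_cyc[OF f, of x a b]
      by (simp add: para_third[OF f] add.assoc)
    then have "?L (H1_class x) =
        lin_ext (\<lambda>q. (- 1) *\<^sub>C (case q of (a, b) \<Rightarrow> ?g b - ?g (a + b) + ?g a)) p"
      by (simp add: case_prod_unfold)
    also have "\<dots> = (- 1) *\<^sub>C lin_ext ?g (bar_d2 p)"
      unfolding lin_ext_bar_d2 by (rule lin_ext_fun(3))
    finally show ?thesis
      unfolding p lin_ext_simps(4) by simp
  qed
  moreover have "clinear (\<lambda>_ :: 'g H1. 0 :: complex)"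
    by (rule clinearI) simp_all
  ultimately show "?L u = 0"
    using H1_eqI[OF L] by blast
qed

text \<open>
  The cochains are \<open>a \<mapsto> - \<Phi>(x \<and> s a)\<close>, where \<open>s\<close> inverts the differential on its image: a chain
  \<open>p\<close> differs from \<open>s (d p)\<close> by a cycle, so every form that vanishes on cycles factors through \<open>d\<close>,
  by a formula linear in the form.
\<close>

lemma E_space_cochains:
  fixes \<Phi> :: "'g::group_add H1 ext3 \<Rightarrow> complex"
  assumes "\<Phi> \<in> E_space"
  obtains h :: "'g \<Rightarrow> 'g \<Rightarrow> complex"
  where "\<And>x y a. h (x + y) a = h x a + h y a"
    and "\<And>x a b. h x (a + b) = h x a + h x b +
      \<Phi> (wedge3 (H1_class x) (H1_class a) (H1_class b))"
proof -
  have lin: "clinear \<Phi>"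
    using assms by (simp add: E_space_iff)
  define L where "L u = lin_ext (\<lambda>(a, b). \<Phi> (wedge3 u (H1_class a) (H1_class b)))" for u
  have L: "L u (p + q) = L u p + L u q" "L u (p - q) = L u p - L u q"
    "L (u + v) p = L u p + L v p" for u v p q
    by (simp_all add: L_def lin_ext_simps case_prod_unfold wedge3_add clinearD[OF lin] lin_ext_fun)
  have L0: "L u p = 0" if "bar_d2 p = 0" for u p
    using assms that by (simp add: E_space_iff L_def)
  obtain s :: "('g \<Rightarrow>\<^sub>0 complex) \<Rightarrow> 'g \<times> 'g \<Rightarrow>\<^sub>0 complex"
    where s: "clinear s" "\<And>p. bar_d2 (s (bar_d2 p)) = bar_d2 p"
    using complex_vector_pair.linear_exists_right_inverse_on
      [OF clinear_bar_d2[where 'a = 'g] complex_vector.subspace_UNIV] by blast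
  have factor: "L u p = L u (s (bar_d2 p))" for u p
    using L0[of "p - s (bar_d2 p)" u] by (simp add: L clinearD[OF clinear_bar_d2] s)
  show thesis
  proof (rule that[of "\<lambda>x a. - L (H1_class x) (s (basis a))"])
    fix x y a b :: 'g
    show "- L (H1_class (x + y)) (s (basis a)) =
        - L (H1_class x) (s (basis a)) + - L (H1_class y) (s (basis a))"
      by (simp add: H1_class_add L)
    have "\<Phi> (wedge3 (H1_class x) (H1_class a) (H1_class b)) = L (H1_class x) (basis (a, b))"
      by (simp add: L_def)
    also have "\<dots> = L (H1_class x) (s (basis b)) - L (H1_class x) (s (basis (a + b)))
        + L (H1_class x) (s (basis a))"
      by (simp only: factor[of _ "basis (a, b)"] bar_d2_single clinearD[OF s(1)] L)
    finally show "- L (H1_class x) (s (basis (a + b))) =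
        - L (H1_class x) (s (basis a)) + - L (H1_class x) (s (basis b)) +
        \<Phi> (wedge3 (H1_class x) (H1_class a) (H1_class b))"
      by simp
  qed
qed

context
  fixes h :: "'g::group_add \<Rightarrow> 'g \<Rightarrow> complex" and T :: "'g \<Rightarrow> 'g \<Rightarrow> 'g \<Rightarrow> complex"
  assumes h_add: "h (x + y) a = h x a + h y a"
    and h_coboundary: "h x (a + b) = h x a + h x b + T x a b"
    and T_add: "T x a (b + c) = T x a b + T x a c"
    and T_alt: "T x x a = 0" "T x a x = 0" "T a x x = 0"
begin

text \<open>
  The correction terms \<open>T x x y\<close> and \<open>T y x y\<close> of the coboundary relation vanish because \<open>T\<close> is
  alternating; this makes the cocycle \<open>h x y + h y x\<close> the second difference of the diagonal.
\<close>

lemma diagonal_second_difference: "h (x + y) (x + y) = h x x + h y y + h x y + h y x"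
  unfolding h_add by (simp add: h_coboundary T_alt)

lemma cochain_minus: "h (- x) a = - h x a" "h x (- a) = - h x a"
proof -
  show "h (- x) a = - h x a"
    using h_add[of 0 0 a] h_add[of x "- x" a] by (simp add: eq_neg_iff_add_eq_0 add.commute)
  have "T x a 0 = 0" for a
    using T_add[of x a 0 0] by simp
  then have "h x 0 = 0" "T x a (- a) = 0"
    using h_coboundary[of x 0 0] T_add[of x a a "- a"] T_alt(3)[of x a] by simp_all
  then show "h x (- a) = - h x a"
    using h_coboundary[of x a "- a"] by (simp add: eq_neg_iff_add_eq_0 add.commute)
qed

lemma diagonal_parallelogram: "(\<lambda>x. h x x) \<in> parallelogram_functions"
  using diagonal_second_difference[of _ "- _"]
  by (simp add: parallelogram_functions_def diagonal_second_difference cochain_minus)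

text \<open>
  The second difference \<open>h x y + h y x\<close> fails to be additive in \<open>x\<close> only through its second term,
  whose defect is a value of \<open>T\<close>.
\<close>

lemma diagonal_third_difference:
  "lin_ext (\<lambda>x. h x x) ((basis a - 1) * (basis b - 1) * (basis c - 1)) = T c a b"
proof -
  have "h 0 0 = 0"
    using h_add[of 0 0 0] by simp
  then show ?thesis
    unfolding third_difference diagonal_second_difference h_coboundary[of c a b]
    by (simp add: h_add)
qed

end

lemma wedge3_cycle: "wedge3 w u v = wedge3 u v w"
proof -
  have "wedge3 (u + w) (u + w) v = 0" "wedge3 u (v + w) (v + w) = 0"
    by (simp_all only: wedge3_self)
  then have "wedge3 u w v + wedge3 w u v = 0" "wedge3 u v w + wedge3 u w v = 0"
    unfolding wedge3_add by (simp_all add: wedge3_self add.commute)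
  then show ?thesis
    by (metis add.commute add_left_cancel)
qed

theorem theorem1p1:
  assumes "finitely_generated (UNIV :: 'g::group_add set)"
  shows "epsilon3_star ` (parallelogram_functions :: ('g \<Rightarrow> complex) set) = E_space"
proof
  show "epsilon3_star ` (parallelogram_functions :: ('g \<Rightarrow> complex) set) \<subseteq> E_space"
    using epsilon3_star_in_E_space by blast
  show "E_space \<subseteq> epsilon3_star ` (parallelogram_functions :: ('g \<Rightarrow> complex) set)"
  proof
    fix \<Phi> :: "'g H1 ext3 \<Rightarrow> complex"
    assume \<Phi>: "\<Phi> \<in> E_space"
    then have lin: "clinear \<Phi>" by (simp add: E_space_iff)
    obtain h :: "'g \<Rightarrow> 'g \<Rightarrow> complex"
      where h: "\<And>x y a. h (x + y) a = h x a + h y a"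
        "\<And>x a b. h x (a + b) = h x a + h x b +
          \<Phi> (wedge3 (H1_class x) (H1_class a) (H1_class b))"
      using E_space_cochains[OF \<Phi>] by blast
    let ?f = "\<lambda>x. h x x"
    let ?T = "\<lambda>a b c. \<Phi> (wedge3 (H1_class a) (H1_class b) (H1_class c))"
    have T: "?T x a (b + c) = ?T x a b + ?T x a c"
      "?T x x a = 0" "?T x a x = 0" "?T a x x = 0" for x a b c
      by (simp_all add: H1_class_add wedge3_add wedge3_self clinearD[OF lin])
    have f: "?f \<in> parallelogram_functions"
      by (rule diagonal_parallelogram[of h ?T, OF h T])
    have "epsilon3_star ?f = \<Phi>"
    proof (rule ext3_H1_eqI[OF epsilon3_star(1)[OF f] lin])
      fix a b c
      show "epsilon3_star ?f (wedge3 (H1_class a) (H1_class b) (H1_class c)) = ?T a b c"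
        unfolding epsilon3_star(2)[OF f] diagonal_third_difference[of h ?T, OF h T]
        by (simp only: wedge3_cycle)
    qed
    then show "\<Phi> \<in> epsilon3_star ` parallelogram_functions"
      using f by (metis image_eqI)
  qed
qed

end
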